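(* Let $n$ be odd and let $B_n$ be the set of $n\times n$ $(0,1)$-matrices. For $A\in B_n$ let $\sigma_0(A)$ be the number of zero entries of $A$. Then \[ AT(n)=\frac{(-1)^{\frac{n(n-1)}{2}}}{n!\,(n-1)!}\sum_{A\in B_n}(-1)^{\sigma_0(A)}\,\mathrm{per}(A)\det(A)^{n-1}. \]
   Context: $\mathrm{per}$ denotes the permanent. A Latin square of order $n$ is an $n\times n$ array with entries in $[n]$ in which each number appears exactly once in each row and each column. Viewing rows and columns as permutations of $[n]$, the sign of a Latin square is the product of the signs of all its rows and all its columns; it is even if its sign is $1$ and odd if $-1$. A Latin square is normalized if its first row is the identity permutation and unipotent if all entries on its main diagonal are equal. $AT(n)=U_n^{\mathrm{E}}-U_n^{\mathrm{O}}$, where $U_n^{\mathrm{E}}$ ($U_n^{\mathrm{O}}$) is the number of normalized unipotent even (odd) Latin squares of order $n$. *)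

theory Defs
  imports "Jordan_Normal_Form.Determinant"
begin

text \<open>Rows, columns and symbols are indexed from 0, so the set \<open>[n]\<close> is rendered as \<open>{0..<n}\<close>.\<close>

definition per :: "'a :: comm_ring_1 mat \<Rightarrow> 'a" where
  "per A = (if dim_row A = dim_col A then
     (\<Sum>p\<in>{p. p permutes {0..<dim_row A}}. \<Prod>i=0..<dim_row A. A $$ (i, p i)) else 0)"

definition latin_square :: "nat \<Rightarrow> nat mat \<Rightarrow> bool" where
  "latin_square n L \<longleftrightarrow>
     L \<in> carrier_mat n n \<and>
     (\<forall>i<n. \<forall>j<n. L $$ (i, j) < n) \<and>
     (\<forall>i<n. \<forall>k<n. \<exists>!j. j < n \<and> L $$ (i, j) = k) \<and>
     (\<forall>j<n. \<forall>k<n. \<exists>!i. i < n \<and> L $$ (i, j) = k)"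

text \<open>Outside the index range the row and column maps are the identity, so that for a Latin
  square of order \<open>n\<close> they are permutations of \<open>{0..<n}\<close> in the sense of \<^const>\<open>permutes\<close>.\<close>

definition row_perm :: "nat mat \<Rightarrow> nat \<Rightarrow> nat \<Rightarrow> nat" where
  "row_perm L i = (\<lambda>j. if j < dim_col L then L $$ (i, j) else j)"

definition col_perm :: "nat mat \<Rightarrow> nat \<Rightarrow> nat \<Rightarrow> nat" where
  "col_perm L j = (\<lambda>i. if i < dim_row L then L $$ (i, j) else i)"

definition latin_sign :: "nat mat \<Rightarrow> int" where
  "latin_sign L = (\<Prod>i=0..<dim_row L. sign (row_perm L i)) * (\<Prod>j=0..<dim_col L. sign (col_perm L j))"

definition normalized :: "nat mat \<Rightarrow> bool" where
  "normalized L \<longleftrightarrow> row_perm L 0 = id"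

definition unipotent :: "nat mat \<Rightarrow> bool" where
  "unipotent L \<longleftrightarrow> (\<forall>i<dim_row L. \<forall>j<dim_row L. L $$ (i, i) = L $$ (j, j))"

definition U_even :: "nat \<Rightarrow> nat" where
  "U_even n = card {L. latin_square n L \<and> normalized L \<and> unipotent L \<and> latin_sign L = 1}"

definition U_odd :: "nat \<Rightarrow> nat" where
  "U_odd n = card {L. latin_square n L \<and> normalized L \<and> unipotent L \<and> latin_sign L = -1}"

definition AT :: "nat \<Rightarrow> int" where
  "AT n = int (U_even n) - int (U_odd n)"

definition binary_mats :: "nat \<Rightarrow> int mat set" where
  "binary_mats n = {A \<in> carrier_mat n n. \<forall>i<n. \<forall>j<n. A $$ (i, j) \<in> {0, 1}}"

definition num_zeros :: "int mat \<Rightarrow> nat" where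
  "num_zeros A = card {(i, j). i < dim_row A \<and> j < dim_col A \<and> A $$ (i, j) = 0}"

end

theory Submission
  imports Defs
begin

text \<open>
  Expanding \<open>per A * det A ^ (n - 1)\<close> gives a sum over \<open>n\<close>-tuples of permutations. Summing over all
  (0,1)-matrices with the sign \<open>(-1) ^ num_zeros A\<close> kills every tuple that leaves some cell of the
  grid uncovered, so exactly the tuples of symbol permutations of Latin squares survive, weighted by
  the signs of all symbol permutations but the first. For odd \<open>n\<close> this weight is unchanged by permuting
  the rows and by permuting the nonzero symbols, and each orbit of size \<open>n! (n - 1)!\<close> contains exactly
  one normalized unipotent square. Finally, the product of all row, column and symbol signs of a Latin
  square is \<open>(-1) ^ (n * (n - 1) div 2)\<close>.
\<close>

section \<open>Signs of permutations of a grid\<close>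

text \<open>An injective relabelling turns the transposition of \<open>a\<close> and
  \<open>b\<close> into that of \<open>f a\<close> and \<open>f b\<close>, so a factorisation into
  transpositions keeps its length.\<close>

lemma sign_map_permutation:
  assumes "finite S" and "p permutes S" and "inj_on f S"
  shows "sign (map_permutation S f p) = sign p"
  using assms(2,1)
proof (induction rule: permutes_induct)
  case id
  then show ?case
    using assms(3) by (simp only: map_permutation_id' sign_id)
next
  case (swap a b p)
  have bij: "bij_betw f S (f ` S)"
    using assms(3) by (simp add: bij_betw_def)
  have "permutation (map_permutation S f p)"
    using map_permutation_permutes[OF bij swap.hyps(4)] assms(1)
    by (meson finite_imageI permutes_imp_permutation)
  moreover have "permutation p"
    using swap.hyps(4) assms(1) permutes_imp_permutation by blast
  moreover have "f a \<noteq> f b"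
    using swap.hyps assms(3) by (auto dest: inj_onD)
  ultimately have signs:
    "sign (Transposition.transpose (f a) (f b) \<circ> map_permutation S f p) = - sign p"
    "sign (Transposition.transpose a b \<circ> p) = - sign p"
    using swap
    by (simp_all only: sign_compose permutation_swap_id sign_swap_id if_False mult_minus1)
  have "map_permutation S f (Transposition.transpose a b \<circ> p) =
      Transposition.transpose (f a) (f b) \<circ> map_permutation S f p"
    using swap.hyps assms(3) by (simp only: map_permutation_compose' map_permutation_transpose)
  then show ?case
    by (simp only: signs)
qed

text \<open>The embedding \<open>e\<close> is kept abstract so that the lemma covers both the rows and the columns of a
  grid.\<close>

lemma sign_fibrewise:
  fixes e :: "'i \<Rightarrow> 'a \<Rightarrow> 'b"
  assumes "finite I" and "finite S"
    and "\<And>i. i \<in> I \<Longrightarrow> p i permutes S"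
    and "inj_on (case_prod e) (I \<times> S)"
    and "\<And>i s. i \<in> I \<Longrightarrow> s \<in> S \<Longrightarrow> F (e i s) = e i (p i s)"
    and "\<And>x. x \<notin> case_prod e ` (I \<times> S) \<Longrightarrow> F x = x"
  shows "permutation F \<and> sign F = (\<Prod>i\<in>I. sign (p i))"
  using assms(1,3-)
proof (induction I arbitrary: F rule: finite_induct)
  case empty
  then have "F = id"
    by auto
  then show ?case
    by simp
next
  case (insert i I)
  \<comment> \<open>\<open>G\<close> is \<open>F\<close> cut down to the fibres over
    \<open>I\<close>, where the induction hypothesis applies; what remains of \<open>F\<close> is a
    copy of \<open>p i\<close> on the new fibre.\<close>
  define G where "G x = (if x \<in> case_prod e ` (I \<times> S) then F x else x)" for x
  have inj: "inj_on (e i) S"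
    using insert.prems(2) by (force simp: inj_on_def)
  have disj: "e i s \<noteq> e j t" if "j \<in> I" "s \<in> S" "t \<in> S" for j s t
    using inj_onD[OF insert.prems(2), of "(i, s)" "(j, t)"] insert.hyps(2) that by auto
  have pi: "p i permutes S"
    using insert.prems(1) by simp
  have G: "permutation G \<and> sign G = (\<Prod>i\<in>I. sign (p i))"
  proof (rule insert.IH)
    show "inj_on (case_prod e) (I \<times> S)"
      using insert.prems(2) by (rule inj_on_subset) auto
    show "G (e j s) = e j (p j s)" if "j \<in> I" "s \<in> S" for j s
      using that insert.prems(3) by (auto simp: G_def)
  qed (use insert.prems(1) in \<open>auto simp: G_def\<close>)
  let ?m = "map_permutation S (e i) (p i)"
  have m_out: "?m x = x" if "x \<notin> e i ` S" for x
    using that by (simp add: map_permutation_def)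
  \<comment> \<open>The fibres are disjoint: \<open>G\<close> moves points within the old fibres
    only, and \<open>?m\<close> within the new one only.\<close>
  have "F x = (?m \<circ> G) x" for x
  proof (cases "x \<in> case_prod e ` (I \<times> S)")
    case True
    then obtain j s where js: "j \<in> I" "s \<in> S" "x = e j s"
      by auto
    then have Fx: "F x = e j (p j s)" and "p j s \<in> S"
      using insert.prems(1,3) permutes_in_image[of "p j" S s] by auto
    then have "F x \<notin> e i ` S"
      using disj js by (metis imageE)
    then show ?thesis
      using True m_out by (simp add: G_def)
  next
    case False
    show ?thesis
    proof (cases "x \<in> e i ` S")
      case True
      then show ?thesis
        using False insert.prems(3) inj by (auto simp: G_def map_permutation_apply)
    next
      case out: False
      then have "F x = x"
        using False by (intro insert.prems(4)) auto
      then show ?thesis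
        using False out m_out by (simp add: G_def)
    qed
  qed
  then have "F = ?m \<circ> G" by blast
  moreover have "permutation ?m"
    using map_permutation_permutes[OF _ pi] inj assms(2)
    by (metis bij_betw_imageI finite_imageI permutes_imp_permutation)
  ultimately show ?case
    using G insert.hyps sign_map_permutation[OF assms(2) pi inj]
    by (simp only: permutation_compose sign_compose prod.insert simp_thms)
qed

text \<open>The map is a product of \<open>card D\<close> disjoint transpositions, because the
  strict inequality keeps \<open>D\<close> apart from its mirror image and off the diagonal. With
  \<open>D\<close> the cells above the diagonal it is the transposition of the grid.\<close>

lemma sign_swap_on:
  fixes D :: "('a :: linorder \<times> 'a) set"
  assumes "finite D" and "\<And>x. x \<in> D \<Longrightarrow> fst x < snd x"
  shows "permutation (\<lambda>x. if x \<in> D \<or> prod.swap x \<in> D then prod.swap x else x) \<and>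
    sign (\<lambda>x. if x \<in> D \<or> prod.swap x \<in> D then prod.swap x else x) = (-1) ^ card D"
  using assms
proof (induction D rule: finite_induct)
  case empty
  show ?case
    by simp
next
  case (insert x D)
  define sw :: "('a \<times> 'a) set \<Rightarrow> 'a \<times> 'a \<Rightarrow> 'a \<times> 'a" where
    "sw = (\<lambda>D x. if x \<in> D \<or> prod.swap x \<in> D then prod.swap x else x)"
  have IH: "permutation (sw D)" "sign (sw D) = (-1) ^ card D"
    using insert.IH[OF insert.prems] by (simp_all add: sw_def)
  have less_x: "fst x < snd x"
    using insert.prems by simp
  have x: "x \<notin> D" "prod.swap x \<notin> D" "prod.swap x \<noteq> x"
    using insert.hyps(2) less_x insert.prems[of "prod.swap x"] by (auto simp: prod_eq_iff)
  \<comment> \<open>Neither \<open>x\<close> nor its mirror image lies in \<open>D\<close>, so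
    \<open>sw D\<close> fixes both and the new transposition acts separately.\<close>
  have "sw (insert x D) y = Transposition.transpose x (prod.swap x) (sw D y)" for y
  proof -
    consider "y = x" | "y = prod.swap x" | "y \<noteq> x" "y \<noteq> prod.swap x"
      by blast
    then show ?thesis
    proof cases
      case 3
      then have "prod.swap y \<noteq> x" "prod.swap y \<noteq> prod.swap x"
        by (metis swap_swap)+
      with 3 show ?thesis
        by (simp add: sw_def)
    qed (use x in \<open>simp_all add: sw_def\<close>)
  qed
  then have "sw (insert x D) = Transposition.transpose x (prod.swap x) \<circ> sw D"
    by (simp only: fun_eq_iff comp_apply simp_thms)
  then have "permutation (sw (insert x D)) \<and> sign (sw (insert x D)) = (-1) ^ card (insert x D)"
    using IH insert.hyps x(3)[symmetric]
    by (simp only: permutation_compose permutation_swap_id sign_compose sign_swap_id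
        card_insert_disjoint if_False power_Suc simp_thms)
  then show ?case
    by (simp only: sw_def)
qed

lemma card_strict_pairs: "card {(i, j). i < j \<and> j < (n :: nat)} = n * (n - 1) div 2"
proof -
  have "{(i, j). i < j \<and> j < n} = prod.swap ` (SIGMA j:{0..<n}. {0..<j})"
    by (auto simp: image_iff)
  then have "card {(i, j). i < j \<and> j < n} = (\<Sum>j = 0..<n. j)"
    by (simp add: card_image)
  also have "\<dots> = n * (n - 1) div 2"
    by (cases n) (simp_all add: Sum_Ico_nat)
  finally show ?thesis .
qed

text \<open>If \<open>k\<close> is the entry in the cell \<open>(i, j)\<close>, then the chain
  \<open>(i, j) \<mapsto> (i, k) \<mapsto> (j, k) \<mapsto> (j, i)\<close> factors the transposition of the grid into the row, the symbol
  and the inverse column permutations.\<close>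

lemma sign_row_col_symbol:
  fixes R C P :: "nat \<Rightarrow> nat \<Rightarrow> nat"
  assumes R: "\<And>i. i < n \<Longrightarrow> R i permutes {0..<n}"
    and C: "\<And>j. j < n \<Longrightarrow> C j permutes {0..<n}"
    and P: "\<And>k. k < n \<Longrightarrow> P k permutes {0..<n}"
    and RC: "\<And>i j. i < n \<Longrightarrow> j < n \<Longrightarrow> C j i = R i j"
    and PR: "\<And>i j. i < n \<Longrightarrow> j < n \<Longrightarrow> P (R i j) i = j"
  shows "(\<Prod>i = 0..<n. sign (R i)) * (\<Prod>j = 0..<n. sign (C j)) * (\<Prod>k = 0..<n. sign (P k)) =
    (-1) ^ (n * (n - 1) div 2)"
proof -
  define \<alpha> where "\<alpha> = (\<lambda>(i, j). if i < n \<and> j < n then (i, R i j) else (i, j))"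
  define \<beta> where "\<beta> = (\<lambda>(i, k). if i < n \<and> k < n then (P k i, k) else (i, k))"
  define \<gamma> where "\<gamma> = (\<lambda>(j, k). if j < n \<and> k < n then (j, Hilbert_Choice.inv (C j) k) else (j, k))"
  have \<alpha>: "permutation \<alpha> \<and> sign \<alpha> = (\<Prod>i = 0..<n. sign (R i))"
    by (rule sign_fibrewise[where e = Pair and S = "{0..<n}"])
      (auto simp: \<alpha>_def R inj_on_def split: if_splits)
  have \<beta>: "permutation \<beta> \<and> sign \<beta> = (\<Prod>k = 0..<n. sign (P k))"
    by (rule sign_fibrewise[where e = "\<lambda>k i. (i, k)" and S = "{0..<n}"])
      (auto simp: \<beta>_def P inj_on_def split: if_splits)
  have \<gamma>: "permutation \<gamma> \<and> sign \<gamma> = (\<Prod>j = 0..<n. sign (Hilbert_Choice.inv (C j)))"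
    by (rule sign_fibrewise[where e = Pair and S = "{0..<n}"])
      (auto simp: \<gamma>_def C permutes_inv inj_on_def split: if_splits)
  \<comment> \<open>The third map of the chain uses inverse column permutations; inversion preserves
    signs.\<close>
  have inv_sign: "(\<Prod>j = 0..<n. sign (Hilbert_Choice.inv (C j))) = (\<Prod>j = 0..<n. sign (C j))"
    by (intro prod.cong refl sign_inverse) (use C permutes_imp_permutation in force)
  let ?D = "{(i, j). i < j \<and> j < n}"
  define sw where "sw = (\<lambda>x. if x \<in> ?D \<or> prod.swap x \<in> ?D then prod.swap x else x)"
  have "finite ?D"
    by (rule finite_subset[of _ "{0..<n} \<times> {0..<n}"]) auto
  then have sw: "sign sw = (-1) ^ (n * (n - 1) div 2)"
    using conjunct2[OF sign_swap_on[of ?D]] unfolding card_strict_pairs sw_def by force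
  have "(\<gamma> \<circ> (\<beta> \<circ> \<alpha>)) (i, j) = sw (i, j)" for i j
  proof (cases "i < n \<and> j < n")
    case True
    then have "R i j < n"
      using permutes_in_image[OF R, of i j] by auto
    moreover have "Hilbert_Choice.inv (C j) (R i j) = i"
      using True permutes_inverses(2)[OF C, of j i] RC by simp
    moreover have "sw (i, j) = (j, i)"
      using True by (cases i j rule: linorder_cases) (simp_all add: sw_def)
    ultimately show ?thesis
      using True PR by (simp add: \<alpha>_def \<beta>_def \<gamma>_def)
  next
    case False
    then have "sw (i, j) = (i, j)" "\<alpha> (i, j) = (i, j)" "\<beta> (i, j) = (i, j)" "\<gamma> (i, j) = (i, j)"
      by (auto simp: sw_def \<alpha>_def \<beta>_def \<gamma>_def)
    then show ?thesis
      by simp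
  qed
  then have "\<gamma> \<circ> (\<beta> \<circ> \<alpha>) = sw"
    by (metis ext surj_pair)
  then have "sign \<gamma> * (sign \<beta> * sign \<alpha>) = (-1) ^ (n * (n - 1) div 2)"
    using sw \<alpha> \<beta> \<gamma> by (metis permutation_compose sign_compose)
  then show ?thesis
    using \<alpha> \<beta> \<gamma> inv_sign by (simp add: mult_ac)
qed

section \<open>Reduction of the matrix sum to Latin squares\<close>

text \<open>A Latin square is encoded by its symbol permutations: \<open>P k i = j\<close> means that the cell
  \<open>(i, j)\<close> contains the symbol \<open>k\<close>.\<close>

definition latin_tuples :: "nat \<Rightarrow> (nat \<Rightarrow> nat \<Rightarrow> nat) set" where
  "latin_tuples n = {P \<in> {0..<n} \<rightarrow>\<^sub>E {p. p permutes {0..<n}}. \<forall>i<n. \<forall>j<n. \<exists>k<n. P k i = j}"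

lemma finite_latin_tuples: "finite (latin_tuples n)"
  unfolding latin_tuples_def
  by (rule finite_subset[of _ "{0..<n} \<rightarrow>\<^sub>E {p. p permutes {0..<n}}"])
    (auto intro!: finite_PiE finite_permutations)

lemma prod_zero_one:
  fixes f :: "'a \<Rightarrow> int"
  assumes "finite S" and "\<And>x. x \<in> S \<Longrightarrow> f x \<in> {0, 1}"
  shows "prod f S = (if \<forall>x\<in>S. f x = 1 then 1 else 0)"
  using assms by (induction S rule: finite_induct) auto

text \<open>A (0,1)-matrix is an independent choice of 0 or 1 in every cell, so distributivity turns
  the sum of products into a product of two-term sums.\<close>

lemma sum_binary_mats:
  fixes h :: "nat \<times> nat \<Rightarrow> int \<Rightarrow> int"
  shows "(\<Sum>A\<in>binary_mats n. \<Prod>c\<in>{0..<n} \<times> {0..<n}. h c (A $$ c)) =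
    (\<Prod>c\<in>{0..<n} \<times> {0..<n}. h c 0 + h c 1)"
proof -
  let ?C = "{0..<n} \<times> {0..<n}"
  have "(\<Sum>A\<in>binary_mats n. \<Prod>c\<in>?C. h c (A $$ c)) =
      (\<Sum>f\<in>?C \<rightarrow>\<^sub>E {0, 1}. \<Prod>c\<in>?C. h c (f c))"
  proof (rule sum.reindex_bij_witness[where
        i = "\<lambda>f. mat n n f" and j = "\<lambda>A. restrict (\<lambda>c. A $$ c) ?C"])
    fix A assume A: "A \<in> binary_mats n"
    show "mat n n (restrict (($$) A) ?C) = A"
      using A by (intro eq_matI) (auto simp: binary_mats_def)
    show "restrict (($$) A) ?C \<in> ?C \<rightarrow>\<^sub>E {0, 1}"
      using A by (force simp: binary_mats_def)
    show "(\<Prod>c\<in>?C. h c (restrict (($$) A) ?C c)) = (\<Prod>c\<in>?C. h c (A $$ c))"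
      by (intro prod.cong) auto
  next
    fix f :: "nat \<times> nat \<Rightarrow> int" assume f: "f \<in> ?C \<rightarrow>\<^sub>E {0, 1}"
    show "restrict (($$) (mat n n f)) ?C = f"
    proof (rule extensionalityI[of _ ?C])
      show "f \<in> extensional ?C"
        using f by (simp add: PiE_def)
    qed auto
    show "mat n n f \<in> binary_mats n"
      using f by (force simp: binary_mats_def PiE_def Pi_def)
  qed
  also have "\<dots> = (\<Prod>c\<in>?C. \<Sum>v\<in>{0, 1}. h c v)"
    by (rule prod_sum_PiE[symmetric]) auto
  finally show ?thesis
    by simp
qed

lemma minus_one_power_num_zeros:
  assumes "A \<in> carrier_mat n n"
  shows "(-1) ^ num_zeros A = (\<Prod>c\<in>{0..<n} \<times> {0..<n}. if A $$ c = 0 then -1 else (1 :: int))"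
proof -
  have "{(i, j). i < dim_row A \<and> j < dim_col A \<and> A $$ (i, j) = 0} =
      {c \<in> {0..<n} \<times> {0..<n}. A $$ c = 0}"
    using assms by auto
  then show ?thesis
    by (simp add: num_zeros_def prod.If_cases Int_def)
qed

text \<open>For a fixed tuple the summand factors over the cells. A covered cell contributes 0 + 1 =
  1 and an uncovered one -1 + 1 = 0, so the sum is the indicator of covering the whole grid.\<close>

lemma signed_sum_cell_products:
  assumes P: "P \<in> {0..<n} \<rightarrow>\<^sub>E {p. p permutes {0..<n}}"
  shows "(\<Sum>A\<in>binary_mats n. (-1) ^ num_zeros A * (\<Prod>k = 0..<n. \<Prod>i = 0..<n. A $$ (i, P k i))) =
    (if P \<in> latin_tuples n then 1 else 0)"
proof -
  let ?C = "{0..<n} \<times> {0..<n}"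
  define cov where "cov = (\<lambda>(k, i). (i, P k i)) ` ?C"
  have P_lt: "P k i < n" if "k < n" "i < n" for k i
    using PiE_mem[OF P, of k] permutes_in_image[of "P k" "{0..<n}" i] that by auto
  have cov_sub: "cov \<subseteq> ?C"
    using P_lt by (auto simp: cov_def)
  \<comment> \<open>\<open>h c v\<close> is the contribution of cell \<open>c\<close> with entry
    \<open>v\<close>: the sign for a zero entry, times the entry itself if the tuple covers the
    cell.\<close>
  define h :: "nat \<times> nat \<Rightarrow> int \<Rightarrow> int" where
    "h c v = (if v = 0 then -1 else 1) * (if c \<in> cov then v else 1)" for c v
  have "(-1) ^ num_zeros A * (\<Prod>k = 0..<n. \<Prod>i = 0..<n. A $$ (i, P k i)) =
      (\<Prod>c\<in>?C. h c (A $$ c))" if A: "A \<in> binary_mats n" for A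
  proof -
    have A01: "A $$ c \<in> {0, 1}" if "c \<in> ?C" for c
      using A that by (cases c) (simp add: binary_mats_def)
    have "(\<Prod>k = 0..<n. \<Prod>i = 0..<n. A $$ (i, P k i)) = (\<Prod>c\<in>?C. A $$ (snd c, P (fst c) (snd c)))"
      by (simp add: prod.cartesian_product case_prod_beta)
    \<comment> \<open>A cell may be covered several times. Passing through the indicator of "all
      covered entries are 1" removes these multiplicities, which do not matter for entries 0 and
      1.\<close>
    also have "\<dots> = (if \<forall>c\<in>?C. A $$ (snd c, P (fst c) (snd c)) = 1 then 1 else 0)"
      by (rule prod_zero_one) (use P_lt in \<open>auto intro!: A01[simplified]\<close>)
    also have "(\<forall>c\<in>?C. A $$ (snd c, P (fst c) (snd c)) = 1) \<longleftrightarrow> (\<forall>c\<in>cov. A $$ c = 1)"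
      by (force simp: cov_def)
    also have "(\<forall>c\<in>cov. A $$ c = 1) \<longleftrightarrow> (\<forall>c\<in>?C. (if c \<in> cov then A $$ c else 1) = 1)"
      using cov_sub by auto
    also have "(if \<dots> then 1 else 0) = (\<Prod>c\<in>?C. if c \<in> cov then A $$ c else 1)"
      by (rule prod_zero_one[symmetric]) (use A01 in auto)
    finally show ?thesis
      using A by (simp add: minus_one_power_num_zeros[of A n] binary_mats_def h_def prod.distrib)
  qed
  then have "(\<Sum>A\<in>binary_mats n. (-1) ^ num_zeros A * (\<Prod>k = 0..<n. \<Prod>i = 0..<n. A $$ (i, P k i))) =
      (\<Prod>c\<in>?C. h c 0 + h c 1)"
    by (simp add: sum_binary_mats)
  also have "\<dots> = (if \<forall>c\<in>?C. h c 0 + h c 1 = 1 then 1 else 0)"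
    by (rule prod_zero_one) (auto simp: h_def)
  also have "(\<forall>c\<in>?C. h c 0 + h c 1 = 1) \<longleftrightarrow> ?C \<subseteq> cov"
    by (auto simp: h_def)
  also have "?C \<subseteq> cov \<longleftrightarrow> P \<in> latin_tuples n"
  proof -
    have "(i, j) \<in> cov \<longleftrightarrow> (\<exists>k<n. P k i = j)" if "i < n" for i j
      using that by (auto simp: cov_def)
    then have "?C \<subseteq> cov \<longleftrightarrow> (\<forall>i<n. \<forall>j<n. \<exists>k<n. P k i = j)"
      by (simp add: subset_iff) blast
    then show ?thesis
      using P by (simp add: latin_tuples_def)
  qed
  finally show ?thesis .
qed

text \<open>Index 0 stands for the factor \<open>per A\<close> and carries no sign; the indices from
  1 to \<open>n - 1\<close> stand for the copies of \<open>det A\<close>. The product of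
  \<open>n\<close> sums is then expanded by distributivity.\<close>

lemma per_times_det_power:
  assumes A: "A \<in> carrier_mat n n" and "n > 0"
  shows "per A * det A ^ (n - 1) =
    (\<Sum>P\<in>{0..<n} \<rightarrow>\<^sub>E {p. p permutes {0..<n}}.
      (\<Prod>k = 1..<n. sign (P k)) * (\<Prod>k = 0..<n. \<Prod>i = 0..<n. A $$ (i, P k i)))"
proof -
  let ?S = "{p. p permutes {0..<n}}"
  define c :: "nat \<Rightarrow> (nat \<Rightarrow> nat) \<Rightarrow> int" where "c k p = (if k = 0 then 1 else sign p)" for k p
  have split: "{0..<n} = insert 0 {1..<n}"
    using \<open>n > 0\<close> by auto
  have det: "det A = (\<Sum>p\<in>?S. c k p * (\<Prod>i = 0..<n. A $$ (i, p i)))" if "k > 0" for k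
    using that by (simp add: det_def'[OF A] c_def)
  have per: "per A = (\<Sum>p\<in>?S. c 0 p * (\<Prod>i = 0..<n. A $$ (i, p i)))"
    using A by (auto simp: per_def c_def)
  have "per A * det A ^ (n - 1) = per A * (\<Prod>k = 1..<n. det A)"
    by simp
  also have "(\<Prod>k = 1..<n. det A) = (\<Prod>k = 1..<n. \<Sum>p\<in>?S. c k p * (\<Prod>i = 0..<n. A $$ (i, p i)))"
    by (intro prod.cong refl det) simp
  also have "per A * \<dots> = (\<Prod>k = 0..<n. \<Sum>p\<in>?S. c k p * (\<Prod>i = 0..<n. A $$ (i, p i)))"
    by (subst (3) split) (simp add: per)
  also have "\<dots> = (\<Sum>P\<in>{0..<n} \<rightarrow>\<^sub>E ?S. \<Prod>k = 0..<n. c k (P k) * (\<Prod>i = 0..<n. A $$ (i, P k i)))"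
    by (rule prod_sum_PiE) (auto intro: finite_permutations)
  also have "\<dots> = (\<Sum>P\<in>{0..<n} \<rightarrow>\<^sub>E ?S.
      (\<Prod>k = 1..<n. sign (P k)) * (\<Prod>k = 0..<n. \<Prod>i = 0..<n. A $$ (i, P k i)))"
  proof (rule sum.cong[OF refl])
    fix P :: "nat \<Rightarrow> nat \<Rightarrow> nat"
    have "(\<Prod>k = 0..<n. c k (P k)) = (\<Prod>k = 1..<n. c k (P k))"
      by (subst split) (simp add: c_def)
    also have "\<dots> = (\<Prod>k = 1..<n. sign (P k))"
      by (intro prod.cong) (auto simp: c_def)
    finally show "(\<Prod>k = 0..<n. c k (P k) * (\<Prod>i = 0..<n. A $$ (i, P k i))) =
      (\<Prod>k = 1..<n. sign (P k)) * (\<Prod>k = 0..<n. \<Prod>i = 0..<n. A $$ (i, P k i))"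
      by (simp add: prod.distrib)
  qed
  finally show ?thesis .
qed

text \<open>After interchanging the sums, the inner sum over matrices is the indicator of the Latin
  tuples.\<close>

lemma sum_per_det_eq_sum_latin_tuples:
  assumes "n > 0"
  shows "(\<Sum>A\<in>binary_mats n. (-1) ^ num_zeros A * per A * det A ^ (n - 1)) =
    (\<Sum>P\<in>latin_tuples n. \<Prod>k = 1..<n. sign (P k))"
proof -
  let ?T = "{0..<n} \<rightarrow>\<^sub>E {p. p permutes {0..<n}}"
  have "(\<Sum>A\<in>binary_mats n. (-1) ^ num_zeros A * per A * det A ^ (n - 1)) =
      (\<Sum>A\<in>binary_mats n. \<Sum>P\<in>?T. (\<Prod>k = 1..<n. sign (P k)) *
        ((-1) ^ num_zeros A * (\<Prod>k = 0..<n. \<Prod>i = 0..<n. A $$ (i, P k i))))"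
  proof (rule sum.cong[OF refl])
    fix A assume "A \<in> binary_mats n"
    then have A: "A \<in> carrier_mat n n"
      by (simp add: binary_mats_def)
    show "(-1) ^ num_zeros A * per A * det A ^ (n - 1) =
        (\<Sum>P\<in>?T. (\<Prod>k = 1..<n. sign (P k)) *
          ((-1) ^ num_zeros A * (\<Prod>k = 0..<n. \<Prod>i = 0..<n. A $$ (i, P k i))))"
      unfolding mult.assoc per_times_det_power[OF A assms] sum_distrib_left
      by (intro sum.cong refl) (simp only: mult_ac)
  qed
  also have "\<dots> = (\<Sum>P\<in>?T. (\<Prod>k = 1..<n. sign (P k)) *
      (\<Sum>A\<in>binary_mats n. (-1) ^ num_zeros A * (\<Prod>k = 0..<n. \<Prod>i = 0..<n. A $$ (i, P k i))))"
    by (subst sum.swap) (simp add: sum_distrib_left)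
  also have "\<dots> = (\<Sum>P\<in>?T. if P \<in> latin_tuples n then \<Prod>k = 1..<n. sign (P k) else 0)"
    by (intro sum.cong refl) (simp add: signed_sum_cell_products)
  also have "\<dots> = (\<Sum>P\<in>?T \<inter> latin_tuples n. \<Prod>k = 1..<n. sign (P k))"
    by (rule sum.inter_restrict[symmetric]) (auto intro!: finite_PiE finite_permutations)
  also have "?T \<inter> latin_tuples n = latin_tuples n"
    by (auto simp: latin_tuples_def)
  finally show ?thesis .
qed

section \<open>Reduction to normalized unipotent squares\<close>

text \<open>\<open>P 0 = id\<close> puts the symbol 0 on the whole main diagonal, and
  \<open>P k 0 = k\<close> makes the first row the identity.\<close>

definition reduced_tuples :: "nat \<Rightarrow> (nat \<Rightarrow> nat \<Rightarrow> nat) set" where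
  "reduced_tuples n = {P \<in> latin_tuples n. P 0 = id \<and> (\<forall>k<n. P k 0 = k)}"

lemma latin_tuples_permutes: "P \<in> latin_tuples n \<Longrightarrow> k < n \<Longrightarrow> P k permutes {0..<n}"
  by (auto simp: latin_tuples_def)

lemma latin_tuples_less: "P \<in> latin_tuples n \<Longrightarrow> k < n \<Longrightarrow> i < n \<Longrightarrow> P k i < n"
  using permutes_in_image[OF latin_tuples_permutes, of P n k i] by simp

lemma latin_tuples_cover:
  assumes "P \<in> latin_tuples n" "i < n" "j < n"
  shows "\<exists>k<n. P k i = j"
  using assms by (simp add: latin_tuples_def)

text \<open>In row \<open>i\<close> the \<open>n\<close> symbols reach all \<open>n\<close> columns,
  so no column is reached twice: covering the grid already means covering it exactly once.\<close>

lemma latin_tuples_inj: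
  assumes "P \<in> latin_tuples n" and "i < n"
  shows "inj_on (\<lambda>k. P k i) {0..<n}"
proof (rule finite_surj_inj[OF finite_atLeastLessThan])
  show "{0..<n} \<subseteq> (\<lambda>k. P k i) ` {0..<n}"
    using latin_tuples_cover[OF assms] by fastforce
qed

lemma latin_tuplesI:
  assumes "P \<in> extensional {0..<n}" and "\<And>k. k < n \<Longrightarrow> P k permutes {0..<n}"
    and "\<And>i j. i < n \<Longrightarrow> j < n \<Longrightarrow> \<exists>k<n. P k i = j"
  shows "P \<in> latin_tuples n"
  using assms by (auto simp: latin_tuples_def PiE_def)

text \<open>Composing all permutations of a tuple with \<open>q\<close> changes the product of the \<open>n - 1\<close> last signs by
  \<open>sign q ^ (n - 1)\<close>, which is \<open>1\<close> for odd \<open>n\<close>; permuting the last \<open>n - 1\<close> members does not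
  change it at all.\<close>

definition assemble :: "nat \<Rightarrow> (nat \<Rightarrow> nat) \<times> (nat \<Rightarrow> nat) \<times> (nat \<Rightarrow> nat \<Rightarrow> nat) \<Rightarrow> nat \<Rightarrow> nat \<Rightarrow> nat" where
  "assemble n = (\<lambda>(q, r, R). \<lambda>k\<in>{0..<n}. R (r k) \<circ> q)"

lemma assemble_latin_tuples:
  assumes q: "q permutes {0..<n}" and r: "r permutes {0..<n}" and R: "R \<in> latin_tuples n"
  shows "assemble n (q, r, R) \<in> latin_tuples n"
proof (rule latin_tuplesI)
  have r_lt: "r k < n" if "k < n" for k
    using permutes_in_image[OF r, of k] that by simp
  show "assemble n (q, r, R) \<in> extensional {0..<n}"
    by (simp add: assemble_def)
  show "assemble n (q, r, R) k permutes {0..<n}" if "k < n" for k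
    using permutes_compose[OF q latin_tuples_permutes[OF R r_lt[OF that]]] that
    by (simp add: assemble_def)
  show "\<exists>k<n. assemble n (q, r, R) k i = j" if "i < n" "j < n" for i j
  proof -
    have "q i < n"
      using permutes_in_image[OF q, of i] that by simp
    then obtain k where k: "k < n" "R k (q i) = j"
      using latin_tuples_cover[OF R _ \<open>j < n\<close>] by blast
    \<comment> \<open>The symbol \<open>k\<close> of \<open>R\<close> becomes the symbol
      \<open>inv r k\<close> of the assembled tuple.\<close>
    have "Hilbert_Choice.inv r k < n"
      using permutes_in_image[OF permutes_inv[OF r], of k] k by simp
    moreover have "assemble n (q, r, R) (Hilbert_Choice.inv r k) i = j"
      using k calculation by (simp add: assemble_def permutes_inverses[OF r])
    ultimately show ?thesis
      by blast
  qed
qed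

lemma permutes_Suc_interval:
  assumes "r permutes {1..<n}"
  shows "r permutes {0..<n}" and "r 0 = (0 :: nat)"
  using assms by (auto intro: permutes_subset simp: permutes_not_in)

lemma prod_sign_assemble:
  assumes "odd n" and q: "q permutes {0..<n}" and r: "r permutes {1..<n}"
    and R: "R \<in> latin_tuples n" and R0: "R 0 = id"
  shows "(\<Prod>k = 1..<n. sign (assemble n (q, r, R) k)) = (\<Prod>k = 0..<n. sign (R k))"
proof -
  have perm: "permutation p" if "p permutes {0..<n}" for p
    using that permutes_imp_permutation by blast
  have r_lt: "r k < n" if "k < n" for k
    using permutes_in_image[OF permutes_Suc_interval(1)[OF r], of k] that by simp
  have "(\<Prod>k = 1..<n. sign (assemble n (q, r, R) k)) = (\<Prod>k = 1..<n. sign (R (r k)) * sign q)"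
    using q R r_lt latin_tuples_permutes perm
    by (intro prod.cong refl) (auto simp: assemble_def intro!: sign_compose)
  also have "\<dots> = (\<Prod>k = 1..<n. sign (R (r k))) * sign q ^ (n - 1)"
    by (simp add: prod.distrib)
  also have "sign q ^ (n - 1) = 1"
    using \<open>odd n\<close> by (cases q rule: sign_cases) simp_all
  also have "(\<Prod>k = 1..<n. sign (R (r k))) = (\<Prod>k = 1..<n. sign (R k))"
    using prod.permute[OF r, of "\<lambda>k. sign (R k)"] by (simp add: comp_def)
  \<comment> \<open>Since \<open>R 0\<close> is the identity, the factor for symbol 0 can be
    adjoined, giving the product over all symbols that the sign identity for squares needs.\<close>
  also have "\<dots> = (\<Prod>k = 0..<n. sign (R k))"
    using \<open>odd n\<close> by (subst (2) prod.atLeast_Suc_lessThan) (auto simp: R0 odd_pos)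
  finally show ?thesis
    by simp
qed

text \<open>This recovers \<open>r\<close> from an assembled tuple with reduced \<open>R\<close>.
  There \<open>P 0 = q\<close>, and the row \<open>a = inv (P 0) 0\<close> satisfies
  \<open>q a = 0\<close>, so \<open>P k a = R (r k) 0 = r k\<close>.\<close>

definition head_perm :: "nat \<Rightarrow> (nat \<Rightarrow> nat \<Rightarrow> nat) \<Rightarrow> nat \<Rightarrow> nat" where
  "head_perm n P = (\<lambda>k. if k < n then P k (Hilbert_Choice.inv (P 0) 0) else k)"

text \<open>Different symbols of one row lie in different columns, and 0 is fixed because the chosen
  row has the symbol 0 in column 0.\<close>

lemma head_perm_permutes:
  assumes P: "P \<in> latin_tuples n" and "n > 0"
  shows "head_perm n P permutes {1..<n}"
proof -
  have P0: "P 0 permutes {0..<n}"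
    using latin_tuples_permutes[OF P] \<open>n > 0\<close> by simp
  let ?a = "Hilbert_Choice.inv (P 0) 0"
  have a: "?a < n"
    using permutes_in_image[OF permutes_inv[OF P0], of 0] \<open>n > 0\<close> by simp
  have inj: "inj_on (head_perm n P) {0..<n}"
    using latin_tuples_inj[OF P a] by (simp add: head_perm_def inj_on_def)
  moreover have "head_perm n P ` {0..<n} \<subseteq> {0..<n}"
    using latin_tuples_less[OF P _ a] by (auto simp: head_perm_def)
  ultimately have "bij_betw (head_perm n P) {0..<n} {0..<n}"
    by (simp add: bij_betw_def endo_inj_surj)
  then have "head_perm n P permutes {0..<n}"
    by (rule bij_imp_permutes) (simp add: head_perm_def)
  then show ?thesis
  proof (rule permutes_superset)
    fix k assume "k \<in> {0..<n} - {1..<n}"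
    then have "k = 0"
      by auto
    then show "head_perm n P k = k"
      using \<open>n > 0\<close> permutes_inverses(1)[OF P0] by (simp add: head_perm_def)
  qed
qed

text \<open>\<open>assemble n\<close> is a bijection from the triples with reduced third component
  onto the Latin tuples. The weight depends on \<open>R\<close> alone, so the choices of
  \<open>q\<close> and \<open>r\<close> contribute the two factorials.\<close>

lemma sum_latin_tuples_eq_sum_reduced:
  assumes "odd n"
  shows "(\<Sum>P\<in>latin_tuples n. \<Prod>k = 1..<n. sign (P k)) =
    fact n * fact (n - 1) * (\<Sum>R\<in>reduced_tuples n. \<Prod>k = 0..<n. sign (R k))"
proof -
  have n: "n > 0"
    using assms by (rule odd_pos)
  let ?Q = "{q. q permutes {0..<n}}"
  let ?S = "{r. r permutes {1..<n}}"
  let ?T = "?Q \<times> ?S \<times> reduced_tuples n"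
  let ?inv = "Hilbert_Choice.inv"
  \<comment> \<open>The conditions on a reduced \<open>R\<close> force this inverse:
    \<open>R 0 = id\<close> gives \<open>q = P 0\<close>, and \<open>R k 0 = k\<close> gives
    \<open>r = head_perm n P\<close>.\<close>
  define disassemble where
    "disassemble P = (P 0, head_perm n P, \<lambda>k\<in>{0..<n}. P (?inv (head_perm n P) k) \<circ> ?inv (P 0))" for P
  have dis_assemble: "disassemble (assemble n x) = x" if "x \<in> ?T" for x
  proof -
    obtain q r R where x: "x = (q, r, R)"
      by (cases x)
    have q: "q permutes {0..<n}" and r: "r permutes {1..<n}" and R: "R \<in> latin_tuples n"
      and R0: "R 0 = id" and Rk: "\<And>k. k < n \<Longrightarrow> R k 0 = k"
      using that x by (auto simp: reduced_tuples_def)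
    note r' = permutes_Suc_interval[OF r]
    have r_lt: "r k < n \<longleftrightarrow> k < n" for k
      using permutes_in_image[OF r'(1), of k] by simp
    have inv_r_lt: "?inv r k < n \<longleftrightarrow> k < n" for k
      using permutes_in_image[OF permutes_inv[OF r'(1)], of k] by simp
    have P0: "assemble n (q, r, R) 0 = q"
      using n by (simp add: assemble_def r'(2) R0)
    have head: "head_perm n (assemble n (q, r, R)) = r"
    proof
      fix k
      show "head_perm n (assemble n (q, r, R)) k = r k"
        using r_lt[of k] Rk permutes_not_in[OF r'(1), of k]
        by (simp add: head_perm_def P0) (simp add: assemble_def permutes_inverses[OF q])
    qed
    have "(\<lambda>k\<in>{0..<n}. assemble n (q, r, R) (?inv r k) \<circ> ?inv q) = R"
    proof (rule extensionalityI[of _ "{0..<n}"])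
      show "R \<in> extensional {0..<n}"
        using R by (simp add: latin_tuples_def PiE_def)
      fix k assume "k \<in> {0..<n}"
      then show "(\<lambda>k\<in>{0..<n}. assemble n (q, r, R) (?inv r k) \<circ> ?inv q) k = R k"
        using inv_r_lt[of k]
        by (simp add: assemble_def permutes_inverses[OF r] permutes_inv_o[OF q] flip: comp_assoc)
          (simp add: fun_eq_iff permutes_inverses[OF q])
    qed simp
    then show ?thesis
      by (simp add: x disassemble_def P0 head)
  qed
  have disassemble: "disassemble P \<in> ?T \<and> assemble n (disassemble P) = P" if P: "P \<in> latin_tuples n" for P
  proof -
    define q r where "q = P 0" and "r = head_perm n P"
    define R where "R = (\<lambda>k\<in>{0..<n}. P (?inv r k) \<circ> ?inv q)"
    have q: "q permutes {0..<n}"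
      using latin_tuples_permutes[OF P n] by (simp add: q_def)
    have r: "r permutes {1..<n}"
      using head_perm_permutes[OF P n] by (simp add: r_def)
    note r' = permutes_Suc_interval[OF r]
    have r_lt: "r k < n \<longleftrightarrow> k < n" for k
      using permutes_in_image[OF r'(1), of k] by simp
    have inv_r_lt: "?inv r k < n \<longleftrightarrow> k < n" for k
      using permutes_in_image[OF permutes_inv[OF r'(1)], of k] by simp
    \<comment> \<open>Undoing \<open>q\<close> and \<open>r\<close> is again an assembly, so
      \<open>R\<close> is Latin by the closure lemma.\<close>
    have "R = assemble n (?inv q, ?inv r, P)"
      by (simp add: R_def assemble_def)
    then have "R \<in> latin_tuples n"
      using assemble_latin_tuples[OF permutes_inv[OF q] permutes_inv[OF r'(1)] P] by simp
    moreover have "?inv r 0 = 0"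
      using r'(2) permutes_inv_eq[OF r] by simp
    then have "R 0 = id"
      using n permutes_inv_o(1)[OF q] by (simp only: R_def q_def[symmetric]) (simp add: q_def)
    moreover have "R k 0 = k" if "k < n" for k
    proof -
      have "R k 0 = r (?inv r k)"
        using that inv_r_lt[of k] by (simp add: R_def r_def head_perm_def q_def)
      then show ?thesis
        by (simp add: permutes_inverses[OF r])
    qed
    ultimately have "R \<in> reduced_tuples n"
      by (simp add: reduced_tuples_def)
    moreover have "assemble n (q, r, R) = P"
    proof (rule extensionalityI[of _ "{0..<n}"])
      show "P \<in> extensional {0..<n}"
        using P by (simp add: latin_tuples_def PiE_def)
      fix k assume "k \<in> {0..<n}"
      then show "assemble n (q, r, R) k = P k"
        using r_lt[of k]
        by (simp add: assemble_def R_def permutes_inverses[OF r] fun_eq_iff permutes_inverses[OF q])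
    qed (simp add: assemble_def)
    moreover have "disassemble P = (q, r, R)"
      by (simp add: disassemble_def q_def r_def R_def)
    ultimately show ?thesis
      using q r by simp
  qed
  have "(\<Sum>P\<in>latin_tuples n. \<Prod>k = 1..<n. sign (P k)) =
      (\<Sum>(q, r, R)\<in>?T. \<Prod>k = 0..<n. sign (R k))"
  proof (rule sum.reindex_bij_witness[where i = "assemble n" and j = disassemble])
    fix x assume x: "x \<in> ?T"
    then show "assemble n x \<in> latin_tuples n"
      by (cases x) (auto simp: reduced_tuples_def intro!: assemble_latin_tuples permutes_Suc_interval)
  next
    fix P assume P: "P \<in> latin_tuples n"
    obtain q r R where dis: "disassemble P = (q, r, R)"
      by (cases "disassemble P")
    then have "(q, r, R) \<in> ?T" "assemble n (q, r, R) = P"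
      using disassemble[OF P] by simp_all
    then show "(case disassemble P of (q, r, R) \<Rightarrow> \<Prod>k = 0..<n. sign (R k)) = (\<Prod>k = 1..<n. sign (P k))"
      using prod_sign_assemble[OF assms, of q r R] by (simp add: dis reduced_tuples_def)
  qed (use disassemble dis_assemble in blast)+
  also have "\<dots> = int (card ?Q) * int (card ?S) * (\<Sum>R\<in>reduced_tuples n. \<Prod>k = 0..<n. sign (R k))"
    by (simp flip: sum.cartesian_product)
  finally show ?thesis
    by (simp add: card_permutations)
qed

section \<open>Latin squares and their symbol permutations\<close>

text \<open>The two defaults differ: beyond the symbols the tuple is undefined, to be extensional,
  while beyond the rows each member is the identity, as \<open>permutes\<close> demands.\<close>

definition symbol_perms :: "nat \<Rightarrow> nat mat \<Rightarrow> nat \<Rightarrow> nat \<Rightarrow> nat" where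
  "symbol_perms n L = (\<lambda>k\<in>{0..<n}. \<lambda>i. if i < n then THE j. j < n \<and> L $$ (i, j) = k else i)"

lemma latin_squareD:
  assumes "latin_square n L"
  shows "L \<in> carrier_mat n n"
    and "i < n \<Longrightarrow> j < n \<Longrightarrow> L $$ (i, j) < n"
    and "i < n \<Longrightarrow> k < n \<Longrightarrow> \<exists>!j. j < n \<and> L $$ (i, j) = k"
    and "j < n \<Longrightarrow> k < n \<Longrightarrow> \<exists>!i. i < n \<and> L $$ (i, j) = k"
  using assms by (simp_all add: latin_square_def)

lemma symbol_perms_props:
  assumes "latin_square n L" and "i < n" and "k < n"
  shows "symbol_perms n L k i < n" and "L $$ (i, symbol_perms n L k i) = k"
  using theI'[OF latin_squareD(3)[OF assms]] assms by (simp_all add: symbol_perms_def)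

lemma symbol_perms_iff:
  assumes "latin_square n L" and "i < n" and "j < n" and "k < n"
  shows "symbol_perms n L k i = j \<longleftrightarrow> L $$ (i, j) = k"
  using symbol_perms_props[OF assms(1,2,4)] latin_squareD(3)[OF assms(1,2,4)] assms(3) by blast

lemma symbol_perms_latin_tuples:
  assumes L: "latin_square n L"
  shows "symbol_perms n L \<in> latin_tuples n"
proof (rule latin_tuplesI)
  show "symbol_perms n L \<in> extensional {0..<n}"
    by (simp add: symbol_perms_def)
  show "symbol_perms n L k permutes {0..<n}" if k: "k < n" for k
  proof (rule bij_imp_permutes)
    have "inj_on (symbol_perms n L k) {0..<n}"
    proof (rule inj_onI)
      fix i i' assume i: "i \<in> {0..<n}" "i' \<in> {0..<n}" "symbol_perms n L k i = symbol_perms n L k i'"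
      then show "i = i'"
        using symbol_perms_props[OF L _ k, of i] symbol_perms_props[OF L _ k, of i']
          latin_squareD(4)[OF L _ k, of "symbol_perms n L k i"] by auto
    qed
    moreover have "symbol_perms n L k ` {0..<n} \<subseteq> {0..<n}"
      using symbol_perms_props(1)[OF L _ k] by auto
    ultimately show "bij_betw (symbol_perms n L k) {0..<n} {0..<n}"
      by (simp add: bij_betw_def endo_inj_surj)
  qed (use k in \<open>simp add: symbol_perms_def\<close>)
  show "\<exists>k<n. symbol_perms n L k i = j" if "i < n" "j < n" for i j
    using symbol_perms_iff[OF L that] latin_squareD(2)[OF L that] by blast
qed

text \<open>Surjectivity of the encoding: each cell is covered by exactly one symbol, and that
  symbol is its entry.\<close>

lemma ex_square_of_latin_tuple:
  assumes P: "P \<in> latin_tuples n"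
  obtains L where "latin_square n L" and "symbol_perms n L = P"
proof
  define L where "L = mat n n (\<lambda>(i, j). THE k. k < n \<and> P k i = j)"
  have ex1: "\<exists>!k. k < n \<and> P k i = j" if "i < n" "j < n" for i j
    using latin_tuples_cover[OF P that] inj_onD[OF latin_tuples_inj[OF P that(1)]] by fastforce
  have L: "L $$ (i, j) < n \<and> P (L $$ (i, j)) i = j" if "i < n" "j < n" for i j
    using theI'[OF ex1[OF that]] that by (simp add: L_def)
  have iff: "L $$ (i, j) = k \<longleftrightarrow> P k i = j" if "i < n" "j < n" "k < n" for i j k
    using L[OF that(1,2)] ex1[OF that(1,2)] that(3) by blast
  show latin: "latin_square n L"
    unfolding latin_square_def
  proof (intro conjI allI impI)
    show "L \<in> carrier_mat n n"
      by (simp add: L_def)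
    show "L $$ (i, j) < n" if "i < n" "j < n" for i j
      using L that by blast
    show "\<exists>!j. j < n \<and> L $$ (i, j) = k" if "i < n" "k < n" for i k
      using iff[OF that(1) _ that(2)] latin_tuples_less[OF P that(2,1)] by metis
    show "\<exists>!i. i < n \<and> L $$ (i, j) = k" if j: "j < n" and k: "k < n" for j k
    proof (rule ex1I)
      \<comment> \<open>In column \<open>j\<close> the symbol \<open>k\<close> stands in the row
        that \<open>P k\<close> sends to \<open>j\<close>.\<close>
      let ?i = "Hilbert_Choice.inv (P k) j"
      note Pk = latin_tuples_permutes[OF P k]
      have "?i < n"
        using permutes_in_image[OF permutes_inv[OF Pk], of j] j by simp
      then show "?i < n \<and> L $$ (?i, j) = k"
        using iff[OF _ j k] permutes_inverses(1)[OF Pk] by simp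
      show "i = ?i" if "i < n \<and> L $$ (i, j) = k" for i
        using that iff[OF _ j k] permutes_inv_eq[OF Pk] by metis
    qed
  qed
  show "symbol_perms n L = P"
  proof (rule extensionalityI[of _ "{0..<n}"])
    show "P \<in> extensional {0..<n}"
      using P by (simp add: latin_tuples_def PiE_def)
    fix k assume "k \<in> {0..<n}"
    then have k: "k < n" by simp
    show "symbol_perms n L k = P k"
    proof
      fix i
      show "symbol_perms n L k i = P k i"
      proof (cases "i < n")
        case True
        then show ?thesis
          using symbol_perms_iff[OF latin True latin_tuples_less[OF P k True] k] 
            iff[OF True latin_tuples_less[OF P k True] k] by simp
      next
        case False
        then show ?thesis
          using permutes_not_in[OF latin_tuples_permutes[OF P k], of i] k by (simp add: symbol_perms_def)
      qed
    qed
  qed (simp add: symbol_perms_def)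
qed

lemma inj_on_symbol_perms: "inj_on (symbol_perms n) {L. latin_square n L}"
proof (rule inj_onI)
  fix L M assume "L \<in> {L. latin_square n L}" "M \<in> {L. latin_square n L}"
    and eq: "symbol_perms n L = symbol_perms n M"
  then have L: "latin_square n L" and M: "latin_square n M"
    by simp_all
  show "L = M"
  proof (rule eq_matI)
    fix i j assume "i < dim_row M" "j < dim_col M"
    then have ij: "i < n" "j < n"
      using latin_squareD(1)[OF M] by auto
    then show "L $$ (i, j) = M $$ (i, j)"
      using symbol_perms_iff[OF L ij] symbol_perms_iff[OF M ij] latin_squareD(2)[OF L ij] eq by metis
  qed (use latin_squareD(1)[OF L] latin_squareD(1)[OF M] in auto)
qed

lemma normalized_unipotent_iff:
  assumes L: "latin_square n L" and n: "n > 0"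
  shows "normalized L \<and> unipotent L \<longleftrightarrow> symbol_perms n L \<in> reduced_tuples n"
proof -
  note iff = symbol_perms_iff[OF L]
  have dims: "dim_row L = n" "dim_col L = n"
    using latin_squareD(1)[OF L] by auto
  have "normalized L \<longleftrightarrow> (\<forall>k<n. L $$ (0, k) = k)"
    by (auto simp: normalized_def row_perm_def dims fun_eq_iff)
  also have "\<dots> \<longleftrightarrow> (\<forall>k<n. symbol_perms n L k 0 = k)"
    using iff[OF n] by blast
  finally have norm: "normalized L \<longleftrightarrow> (\<forall>k<n. symbol_perms n L k 0 = k)" .
  have "unipotent L \<longleftrightarrow> symbol_perms n L 0 = id" if "normalized L"
  proof -
    \<comment> \<open>The first row being the identity fixes this diagonal entry, so the common
      diagonal symbol can only be 0.\<close>
    have "L $$ (0, 0) = 0"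
      using that iff[OF n n n] n unfolding norm by simp
    then have "unipotent L \<longleftrightarrow> (\<forall>i<n. L $$ (i, i) = 0)"
      using n unfolding unipotent_def dims by metis
    also have "\<dots> \<longleftrightarrow> (\<forall>i<n. symbol_perms n L 0 i = i)"
      using iff[OF _ _ n] by blast
    also have "\<dots> \<longleftrightarrow> symbol_perms n L 0 = id"
      using n by (auto simp: fun_eq_iff symbol_perms_def)
    finally show ?thesis .
  qed
  then show ?thesis
    using norm symbol_perms_latin_tuples[OF L] by (auto simp: reduced_tuples_def)
qed

section \<open>Signs of Latin squares and the signed count\<close>

lemma row_perm_permutes:
  assumes L: "latin_square n L" and i: "i < n"
  shows "row_perm L i permutes {0..<n}"
proof (rule bij_imp_permutes)
  have dims: "dim_col L = n"
    using latin_squareD(1)[OF L] by auto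
  have "inj_on (row_perm L i) {0..<n}"
  proof (rule inj_onI)
    fix x y assume "x \<in> {0..<n}" "y \<in> {0..<n}" "row_perm L i x = row_perm L i y"
    then show "x = y"
      using latin_squareD(2)[OF L i, of x]
        latin_squareD(3)[OF L i, of "L $$ (i, x)"]
      by (auto simp: row_perm_def dims)
  qed
  moreover have "row_perm L i ` {0..<n} \<subseteq> {0..<n}"
    using latin_squareD(2)[OF L i] by (auto simp: row_perm_def dims)
  ultimately show "bij_betw (row_perm L i) {0..<n} {0..<n}"
    by (simp add: bij_betw_def endo_inj_surj)
  show "row_perm L i j = j" if "j \<notin> {0..<n}" for j
    using that by (simp add: row_perm_def dims)
qed

lemma col_perm_permutes:
  assumes L: "latin_square n L" and j: "j < n"
  shows "col_perm L j permutes {0..<n}"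
proof (rule bij_imp_permutes)
  have dims: "dim_row L = n"
    using latin_squareD(1)[OF L] by auto
  have "inj_on (col_perm L j) {0..<n}"
  proof (rule inj_onI)
    fix x y assume "x \<in> {0..<n}" "y \<in> {0..<n}" "col_perm L j x = col_perm L j y"
    then show "x = y"
      using latin_squareD(2)[OF L _ j, of x]
        latin_squareD(4)[OF L j, of "L $$ (x, j)"]
      by (auto simp: col_perm_def dims)
  qed
  moreover have "col_perm L j ` {0..<n} \<subseteq> {0..<n}"
    using latin_squareD(2)[OF L _ j] by (auto simp: col_perm_def dims)
  ultimately show "bij_betw (col_perm L j) {0..<n} {0..<n}"
    by (simp add: bij_betw_def endo_inj_surj)
  show "col_perm L j i = i" if "i \<notin> {0..<n}" for i
    using that by (simp add: col_perm_def dims)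
qed

lemma prod_sign_cases: "(\<Prod>i\<in>I. sign (p i)) = 1 \<or> (\<Prod>i\<in>I. sign (p i)) = - 1"
  by (induction I rule: infinite_finite_induct) (auto simp: sign_def)

text \<open>The sign identity for rows, columns and symbols, solved for the first two: the product
  of the symbol signs is 1 or -1, hence its own inverse.\<close>

lemma latin_sign_eq_prod_symbol_perms:
  assumes L: "latin_square n L"
  shows "latin_sign L = (-1) ^ (n * (n - 1) div 2) * (\<Prod>k = 0..<n. sign (symbol_perms n L k))"
proof -
  have dims: "dim_row L = n" "dim_col L = n"
    using latin_squareD(1)[OF L] by auto
  have "latin_sign L * (\<Prod>k = 0..<n. sign (symbol_perms n L k)) = (-1) ^ (n * (n - 1) div 2)"
    unfolding latin_sign_def dims
  proof (rule sign_row_col_symbol)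
    show "symbol_perms n L (row_perm L i j) i = j" if "i < n" "j < n" for i j
      using symbol_perms_iff[OF L that] latin_squareD(2)[OF L that] that by (simp add: row_perm_def dims)
  qed (use row_perm_permutes[OF L] col_perm_permutes[OF L]
      latin_tuples_permutes[OF symbol_perms_latin_tuples[OF L]] in
      \<open>auto simp: row_perm_def col_perm_def dims\<close>)
  then show ?thesis
    using prod_sign_cases[of "symbol_perms n L" "{0..<n}"] by auto
qed

text \<open>The difference of the two counts is the sum of the signs of all normalized unipotent
  squares, which the encoding carries over to the reduced tuples.\<close>

lemma AT_eq_sum_reduced_tuples:
  assumes "n > 0"
  shows "AT n = (-1) ^ (n * (n - 1) div 2) * (\<Sum>P\<in>reduced_tuples n. \<Prod>k = 0..<n. sign (P k))"
proof -
  define N where "N = {L. latin_square n L \<and> normalized L \<and> unipotent L}"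
  have inj: "inj_on (symbol_perms n) N"
    by (rule inj_on_subset[OF inj_on_symbol_perms]) (auto simp: N_def)
  have img: "symbol_perms n ` N = reduced_tuples n"
  proof (intro equalityI subsetI)
    show "P \<in> reduced_tuples n" if "P \<in> symbol_perms n ` N" for P
      using that normalized_unipotent_iff[OF _ assms] by (auto simp: N_def)
    show "P \<in> symbol_perms n ` N" if "P \<in> reduced_tuples n" for P
    proof -
      from that have "P \<in> latin_tuples n"
        by (simp add: reduced_tuples_def)
      then obtain L where "latin_square n L" "symbol_perms n L = P"
        by (rule ex_square_of_latin_tuple)
      then show ?thesis
        using that normalized_unipotent_iff[OF _ assms, of L] by (auto simp: N_def)
    qed
  qed
  have "finite (reduced_tuples n)"
    by (rule finite_subset[OF _ finite_latin_tuples[of n]]) (auto simp: reduced_tuples_def)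
  then have fin: "finite N"
    using inj img by (metis finite_imageD)
  have sign_cases: "latin_sign L = 1 \<or> latin_sign L = - 1" for L
    using prod_sign_cases[of "row_perm L" "{0..<dim_row L}"] prod_sign_cases[of "col_perm L" "{0..<dim_col L}"]
    by (auto simp: latin_sign_def)
  \<comment> \<open>A sign takes only the values 1 and -1, so it is the difference of the two
    indicators.\<close>
  have "(\<Sum>L\<in>N. latin_sign L) = (\<Sum>L\<in>N. (if latin_sign L = 1 then 1 else 0) - (if latin_sign L = -1 then 1 else 0))"
    by (intro sum.cong refl) (use sign_cases in force)
  also have "\<dots> = int (card {L \<in> N. latin_sign L = 1}) - int (card {L \<in> N. latin_sign L = -1})"
    using fin by (simp add: sum_subtractf Int_def flip: sum.inter_filter)
  also have "\<dots> = AT n"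
    by (simp add: AT_def U_even_def U_odd_def N_def conj_assoc)
  finally have "AT n = (\<Sum>L\<in>N. latin_sign L)" ..
  also have "\<dots> = (\<Sum>L\<in>N. (-1) ^ (n * (n - 1) div 2) * (\<Prod>k = 0..<n. sign (symbol_perms n L k)))"
    by (intro sum.cong refl latin_sign_eq_prod_symbol_perms) (simp add: N_def)
  also have "\<dots> = (\<Sum>P\<in>reduced_tuples n. (-1) ^ (n * (n - 1) div 2) * (\<Prod>k = 0..<n. sign (P k)))"
    unfolding img[symmetric] by (simp add: sum.reindex[OF inj])
  finally show ?thesis
    by (simp add: sum_distrib_left)
qed

theorem theorem5:
  fixes n :: nat
  assumes "odd n"
  shows "real_of_int (AT n) =
    (-1) ^ (n * (n - 1) div 2) / (fact n * fact (n - 1)) *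
    real_of_int (\<Sum>A\<in>binary_mats n. (-1) ^ num_zeros A * per A * det A ^ (n - 1))"
proof -
  have n: "n > 0"
    using assms by (rule odd_pos)
  show ?thesis
    \<comment> \<open>Both sides become multiples of the same sum over reduced tuples; the nonzero
      factorials cancel in the reals.\<close>
    unfolding sum_per_det_eq_sum_latin_tuples[OF n] sum_latin_tuples_eq_sum_reduced[OF assms]
      AT_eq_sum_reduced_tuples[OF n]
    by simp
qed

end
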